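(* Let $\omega$ be a weight function with $\gamma(\omega)<+\infty$. Put $\mathcal{I}_{\omega}:=(0,\gamma(\omega)^{-1})$ if $\gamma(\omega)>0$ and $\mathcal{I}_{\omega}:=(0,+\infty)$ if $\gamma(\omega)=0$. For $a\in\mathcal{I}_{\omega}$ let $\tau_a:=\omega^{1/a}$, i.e. $\tau_a(t):=\omega(t^{1/a})$ for $t\ge 0$. Then: (1) The functions $\tau_a$, $a\in\mathcal{I}_{\omega}$, are weight functions which are pairwise non-equivalent (so they form an uncountable family of pairwise non-equivalent weight functions), and for each $a\in\mathcal{I}_{\omega}$ there does not exist a weight function $\sigma$ which is equivalent to $\tau_a$ and almost subadditive. In particular, no $\tau_a$ is itself almost subadditive. (2) If $\omega$ is a BMT-weight function, then each $\tau_a$, $a\in\mathcal{I}_{\omega}$, is a BMT-weight function; if $\omega$ is a normalized BMT-weight function, then each $\tau_a$, $a\in\mathcal{I}_{\omega}$, is a normalized BMT-weight function.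
   Context: A weight function is a function $\omega:[0,+\infty)\to[0,+\infty)$ which is non-decreasing and satisfies $\lim_{t\to+\infty}\omega(t)=+\infty$. Growth index: for $\gamma>0$, a weight function $\omega$ has property $(P_{\omega,\gamma})$ if there exists $K>1$ such that $\limsup_{t\to+\infty}\frac{\omega(K^{\gamma}t)}{\omega(t)}<K$. Set $\gamma(\omega):=\sup\{\gamma>0:(P_{\omega,\gamma})\text{ is satisfied}\}\in[0,+\infty]$, with $\gamma(\omega):=0$ if $(P_{\omega,\gamma})$ holds for no $\gamma>0$. Two functions $\sigma,\tau:[0,+\infty)\to[0,+\infty)$ are equivalent if $\sigma(t)=O(\tau(t))$ and $\tau(t)=O(\sigma(t))$ as $t\to+\infty$. A weight function $\omega$ is almost subadditive if for every $q>1$ there exists $C_q\ge 1$ such that for all $s,t\ge 0$: $\omega(s+t)\le q(\omega(s)+\omega(t))+C_q$. A BMT-weight function is a function $\omega:[0,+\infty)\to[0,+\infty)$ which is continuous, non-decreasing, with $\omega(0)=0$, and such that $\omega(2t)=O(\omega(t))$ as $t\to+\infty$, $\log(t)=o(\omega(t))$ as $t\to+\infty$, and $t\mapsto\omega(e^t)$ is convex on $\mathbb{R}$. It is called normalized if $\omega(t)=0$ for all $0\le t\le 1$. *)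

theory Defs
  imports "HOL-Analysis.Analysis" "HOL-Library.Landau_Symbols"
begin

text \<open>Functions on \<open>[0, \<infinity>)\<close> are represented by functions of type \<open>real \<Rightarrow> real\<close>; none of the
  notions below depends on the values at negative arguments.\<close>

definition weight_function :: "(real \<Rightarrow> real) \<Rightarrow> bool" where
  "weight_function \<omega> \<longleftrightarrow>
     (\<forall>t\<ge>0. 0 \<le> \<omega> t) \<and> mono_on {0..} \<omega> \<and> filterlim \<omega> at_top at_top"

text \<open>The quotient is only relevant for large \<open>t\<close>, where a weight function is positive. The
  limes superior is taken in the extended reals, since it may be infinite.\<close>

definition growth_property :: "(real \<Rightarrow> real) \<Rightarrow> real \<Rightarrow> bool" where
  "growth_property \<omega> \<gamma> \<longleftrightarrow>
     (\<exists>K>1. Limsup at_top (\<lambda>t. ereal (\<omega> (K powr \<gamma> * t) / \<omega> t)) < ereal K)"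

definition growth_index :: "(real \<Rightarrow> real) \<Rightarrow> ereal" where
  "growth_index \<omega> =
     (if \<exists>\<gamma>>0. growth_property \<omega> \<gamma>
      then (SUP \<gamma>\<in>{\<gamma>. 0 < \<gamma> \<and> growth_property \<omega> \<gamma>}. ereal \<gamma>)
      else 0)"

definition equivalent_functions :: "(real \<Rightarrow> real) \<Rightarrow> (real \<Rightarrow> real) \<Rightarrow> bool" where
  "equivalent_functions \<sigma> \<tau> \<longleftrightarrow> \<sigma> \<in> O[at_top](\<tau>) \<and> \<tau> \<in> O[at_top](\<sigma>)"

definition almost_subadditive :: "(real \<Rightarrow> real) \<Rightarrow> bool" where
  "almost_subadditive \<omega> \<longleftrightarrow>
     (\<forall>q>1. \<exists>C\<ge>1. \<forall>s\<ge>0. \<forall>t\<ge>0. \<omega> (s + t) \<le> q * (\<omega> s + \<omega> t) + C)"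

definition BMT_weight_function :: "(real \<Rightarrow> real) \<Rightarrow> bool" where
  "BMT_weight_function \<omega> \<longleftrightarrow>
     (\<forall>t\<ge>0. 0 \<le> \<omega> t) \<and> continuous_on {0..} \<omega> \<and> mono_on {0..} \<omega> \<and> \<omega> 0 = 0 \<and>
     (\<lambda>t. \<omega> (2 * t)) \<in> O[at_top](\<omega>) \<and>
     (\<lambda>t. ln t) \<in> o[at_top](\<omega>) \<and>
     convex_on UNIV (\<lambda>x. \<omega> (exp x))"

definition normalized :: "(real \<Rightarrow> real) \<Rightarrow> bool" where
  "normalized \<omega> \<longleftrightarrow> (\<forall>t. 0 \<le> t \<and> t \<le> 1 \<longrightarrow> \<omega> t = 0)"

definition index_interval :: "(real \<Rightarrow> real) \<Rightarrow> real set" where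
  "index_interval \<omega> =
     (if growth_index \<omega> > 0 then {a. 0 < a \<and> ereal a < inverse (growth_index \<omega>)} else {0<..})"

text \<open>The function \<open>\<omega>\<^sup>1\<^sup>/\<^sup>a\<close>, a power substitution rather than a pointwise power. Note that
  \<open>0 powr (1 / a) = 0\<close>, so the value at \<open>0\<close> is \<open>\<omega> 0\<close>, as it should be.\<close>

definition power_substitution :: "(real \<Rightarrow> real) \<Rightarrow> real \<Rightarrow> real \<Rightarrow> real" where
  "power_substitution \<omega> a = (\<lambda>t. \<omega> (t powr (1 / a)))"

end

theory Submission
  imports Defs "HOL-Real_Asymp.Real_Asymp"
begin

text \<open>If \<open>\<tau>\<^sub>a\<close> and \<open>\<tau>\<^sub>b\<close> with \<open>a < b\<close> are equivalent, then \<open>\<omega> (t\<^sup>r) = O(\<omega> t)\<close> for \<open>r = b / a > 1\<close>, and since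
  \<open>K\<^sup>\<gamma> t \<le> t\<^sup>r\<close> eventually, \<open>\<omega>\<close> has every growth property: its growth index is infinite. If
  \<open>\<tau>\<^sub>a\<close> is equivalent to an almost subadditive \<open>\<sigma>\<close>, then \<open>\<sigma> (2\<^sup>n t) \<le> r\<^sup>n \<sigma> t\<close> eventually, for
  every \<open>r > 2\<close>. This passes to \<open>\<tau>\<^sub>a\<close> up to a factor independent of \<open>n\<close>, which for large \<open>n\<close> is
  absorbed by increasing \<open>r\<close>. Hence \<open>\<omega>\<close> has the growth property for every \<open>\<delta> < 1 / a\<close>, and the
  growth index is at least \<open>1 / a\<close>.\<close>

section \<open>Powers and iterated doubling\<close>

lemma filterlim_powr_at_top:
  fixes p :: real
  assumes "p > 0"
  shows "filterlim (\<lambda>t. t powr p) at_top at_top"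
  using assms by real_asymp

text \<open>Used both for almost subadditive functions and for the doubling condition of BMT-weight
  functions. The hypothesis still applies at \<open>2 ^ n * t\<close>, since this tends to infinity
  with \<open>t\<close>.\<close>

lemma eventually_iterate_doubling:
  fixes f :: "real \<Rightarrow> real"
  assumes "\<forall>\<^sub>F t in at_top. f (2 * t) \<le> C * f t" and "C \<ge> 0"
  shows "\<forall>\<^sub>F t in at_top. f (2 ^ n * t) \<le> C ^ n * f t"
proof (induction n)
  case 0
  show ?case by simp
next
  case (Suc n)
  have "filterlim (\<lambda>t::real. 2 ^ n * t) at_top at_top"
    by (rule filterlim_tendsto_pos_mult_at_top[OF tendsto_const _ filterlim_ident]) simp
  from eventually_compose_filterlim[OF assms(1) this] Suc show ?case
  proof eventually_elim
    case (elim t)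
    have "f (2 ^ Suc n * t) \<le> C * f (2 ^ n * t)"
      using elim(1) by (simp add: mult.assoc)
    also have "\<dots> \<le> C * (C ^ n * f t)"
      using elim(2) assms(2) by (rule mult_left_mono)
    finally show ?case by (simp add: mult.assoc)
  qed
qed

section \<open>Weight functions, growth properties and almost subadditivity\<close>

lemma weight_function_eventually_ge:
  assumes "weight_function \<omega>"
  shows "\<forall>\<^sub>F t in at_top. c \<le> \<omega> t"
  using assms by (simp add: weight_function_def filterlim_at_top)

lemma weight_function_mono:
  assumes "weight_function \<omega>" "0 \<le> s" "s \<le> t"
  shows "\<omega> s \<le> \<omega> t"
  using assms by (auto simp: weight_function_def intro: mono_onD[where A = "{0..}"])

lemma bigo_weight_functionE:
  assumes "f \<in> O[at_top](g)" "weight_function f" "weight_function g"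
  obtains C where "C > 0" "\<forall>\<^sub>F t in at_top. f t \<le> C * g t"
proof -
  from assms(1) obtain C where C: "C > 0" "\<forall>\<^sub>F t in at_top. norm (f t) \<le> C * norm (g t)"
    by (elim landau_o.bigE)
  from C(2) weight_function_eventually_ge[OF assms(2), of 0]
    weight_function_eventually_ge[OF assms(3), of 0]
  have "\<forall>\<^sub>F t in at_top. f t \<le> C * g t"
    by eventually_elim simp
  with C(1) show thesis by (rule that)
qed

text \<open>The gap between \<open>c\<close> and \<open>K\<close> keeps the inequality strict after
  passing to the limes superior. Dividing by \<open>\<omega> t\<close> is harmless because
  eventually \<open>\<omega> t\<close> is at least 1.\<close>

lemma growth_propertyI:
  assumes "weight_function \<omega>" "K > 1" "c < K"
    and "\<forall>\<^sub>F t in at_top. \<omega> (K powr \<gamma> * t) \<le> c * \<omega> t"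
  shows "growth_property \<omega> \<gamma>"
proof -
  from assms(4) weight_function_eventually_ge[OF assms(1), of 1]
  have "\<forall>\<^sub>F t in at_top. ereal (\<omega> (K powr \<gamma> * t) / \<omega> t) \<le> ereal c"
    by eventually_elim (simp add: field_simps)
  then have "Limsup at_top (\<lambda>t. ereal (\<omega> (K powr \<gamma> * t) / \<omega> t)) \<le> ereal c"
    by (rule Limsup_bounded)
  also have "\<dots> < ereal K" using assms(3) by simp
  finally show ?thesis using assms(2) by (auto simp: growth_property_def)
qed

lemma growth_property_le_growth_index:
  assumes "growth_property \<omega> \<gamma>" "\<gamma> > 0"
  shows "ereal \<gamma> \<le> growth_index \<omega>"
  using assms by (auto simp: growth_index_def intro: SUP_upper)

lemma growth_property_if_powr_bigo:
  assumes w: "weight_function \<omega>" and "r > 1"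
    and "\<forall>\<^sub>F t in at_top. \<omega> (t powr r) \<le> C * \<omega> t"
  shows "growth_property \<omega> \<gamma>"
proof -
  define K where "K = max C 1 + 1"
  have "K > 1" "C < K" by (auto simp: K_def)
  have "\<forall>\<^sub>F t in at_top. K powr \<gamma> * t \<le> t powr r"
    using \<open>r > 1\<close> by real_asymp
  then have "\<forall>\<^sub>F t in at_top. \<omega> (K powr \<gamma> * t) \<le> C * \<omega> t"
    using assms(3) eventually_ge_at_top[of 0]
  proof eventually_elim
    case (elim t)
    then have "\<omega> (K powr \<gamma> * t) \<le> \<omega> (t powr r)"
      by (intro weight_function_mono[OF w]) auto
    with elim(2) show ?case by simp
  qed
  with w \<open>K > 1\<close> \<open>C < K\<close> show ?thesis by (rule growth_propertyI)
qed

text \<open>On the diagonal \<open>s = t\<close>, almost subadditivity gives the factor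
  \<open>2 * q\<close>, with \<open>q\<close> as close to 1 as desired; the additive constant is
  absorbed because \<open>\<sigma>\<close> tends to infinity.\<close>

lemma almost_subadditive_doubling:
  assumes "almost_subadditive \<sigma>" "weight_function \<sigma>" "r > 2"
  shows "\<forall>\<^sub>F t in at_top. \<sigma> (2 * t) \<le> r * \<sigma> t"
proof -
  \<comment> \<open>The midpoint of 1 and \<open>r / 2\<close>.\<close>
  define q where "q = (r + 2) / 4"
  have q: "q > 1" "2 * q < r" using assms(3) by (auto simp: q_def field_simps)
  from assms(1) q(1) obtain C where C: "\<forall>s\<ge>0. \<forall>t\<ge>0. \<sigma> (s + t) \<le> q * (\<sigma> s + \<sigma> t) + C"
    unfolding almost_subadditive_def by blast
  from weight_function_eventually_ge[OF assms(2), of "C / (r - 2 * q)"] eventually_ge_at_top[of 0]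
  show ?thesis
  proof eventually_elim
    case (elim t)
    then have "C \<le> (r - 2 * q) * \<sigma> t" using q by (simp add: field_simps)
    moreover have "\<sigma> (t + t) \<le> q * (\<sigma> t + \<sigma> t) + C" using C elim by blast
    ultimately show ?case by (simp add: algebra_simps)
  qed
qed

section \<open>The index interval\<close>

lemma index_interval_pos: "a \<in> index_interval \<omega> \<Longrightarrow> a > 0"
  by (auto simp: index_interval_def split: if_splits)

text \<open>A single bound covering both cases of \<open>index_interval\<close>. An infinite growth
  index cannot occur here, because its inverse is 0 and leaves no room for \<open>a\<close>.\<close>

lemma index_interval_growth_index_less:
  assumes "a \<in> index_interval \<omega>"
  shows "growth_index \<omega> < ereal (1 / a)"
proof -
  have a: "a > 0" using assms by (rule index_interval_pos)
  show ?thesis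
  proof (cases "growth_index \<omega> > 0")
    case True
    then have "ereal a < inverse (growth_index \<omega>)"
      using assms by (simp add: index_interval_def)
    with True a show ?thesis
      by (cases "growth_index \<omega>") (auto simp: field_simps)
  next
    case False
    then have "growth_index \<omega> \<le> 0" by simp
    also have "0 < ereal (1 / a)" using a by simp
    finally show ?thesis .
  qed
qed

lemma uncountable_index_interval:
  assumes "growth_index \<omega> < \<infinity>"
  shows "uncountable (index_interval \<omega>)"
proof -
  have "\<exists>b>0. {0<..<b} \<subseteq> index_interval \<omega>"
  proof (cases "growth_index \<omega> > 0")
    case True
    then show ?thesis using assms
      by (cases "growth_index \<omega>")
        (auto simp: index_interval_def intro!: exI[of _ "inverse (real_of_ereal (growth_index \<omega>))"])
  next
    case False
    then show ?thesis by (auto simp: index_interval_def intro!: exI[of _ 1])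
  qed
  then show ?thesis using countable_subset uncountable_open_interval by blast
qed

section \<open>Power substitutions and their pairwise non-equivalence\<close>

lemma weight_function_power_substitution:
  assumes "weight_function \<omega>" "a > 0"
  shows "weight_function (power_substitution \<omega> a)"
proof -
  have "filterlim (\<lambda>t. \<omega> (t powr (1 / a))) at_top at_top"
    using assms by (intro filterlim_compose[OF _ filterlim_powr_at_top])
      (auto simp: weight_function_def)
  moreover have "mono_on {0..} (\<lambda>t. \<omega> (t powr (1 / a)))"
    using assms by (intro mono_onI weight_function_mono[OF assms(1)] powr_mono2) auto
  ultimately show ?thesis using assms by (auto simp: weight_function_def power_substitution_def)
qed

lemma power_substitution_powr:
  assumes "a \<noteq> 0" "t \<ge> 0"
  shows "power_substitution \<omega> a (t powr a) = \<omega> t"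
  using assms by (simp add: power_substitution_def powr_powr)

text \<open>Evaluating at \<open>t powr b\<close> turns \<open>\<tau>\<close> with parameter
  \<open>b\<close> into \<open>\<omega> t\<close> and \<open>\<tau>\<close> with parameter
  \<open>a\<close> into \<open>\<omega> (t powr (b / a))\<close>, where the exponent exceeds 1.
  Refuting this one direction settles equivalence for either order of the parameters, as equivalence
  includes both directions.\<close>

lemma power_substitution_not_bigo:
  assumes w: "weight_function \<omega>" and fin: "growth_index \<omega> < \<infinity>" and "0 < a" "a < b"
  shows "power_substitution \<omega> a \<notin> O[at_top](power_substitution \<omega> b)"
proof
  have b: "b > 0" using assms(3,4) by simp
  assume "power_substitution \<omega> a \<in> O[at_top](power_substitution \<omega> b)"
  then obtain C where
    C: "\<forall>\<^sub>F t in at_top. power_substitution \<omega> a t \<le> C * power_substitution \<omega> b t"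
    using assms by (elim bigo_weight_functionE) (auto intro!: weight_function_power_substitution)
  have "\<forall>\<^sub>F t in at_top. \<omega> (t powr (b / a)) \<le> C * \<omega> t"
    using eventually_compose_filterlim[OF C filterlim_powr_at_top[OF b]] eventually_ge_at_top[of 0]
  proof eventually_elim
    case (elim t)
    then show ?case using assms(3,4) by (simp add: power_substitution_def powr_powr)
  qed
  then have "growth_property \<omega> \<gamma>" for \<gamma>
    using assms(3,4) by (intro growth_property_if_powr_bigo[OF w, of "b / a"]) auto
  then have *: "ereal \<gamma> \<le> growth_index \<omega>" if "\<gamma> > 0" for \<gamma>
    using that by (intro growth_property_le_growth_index)
  have "growth_index \<omega> = \<infinity>"
  proof (rule ereal_top)
    fix B
    have "ereal B \<le> ereal (max B 1)" by simp
    also have "\<dots> \<le> growth_index \<omega>" by (rule *) simp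
    finally show "ereal B \<le> growth_index \<omega>" .
  qed
  with fin show False by simp
qed

section \<open>Non-equivalence to almost subadditive functions\<close>

lemma growth_property_if_equivalent_almost_subadditive:
  assumes w: "weight_function \<omega>" and a: "a > 0" and \<sigma>: "weight_function \<sigma>"
    and eq: "equivalent_functions \<sigma> (power_substitution \<omega> a)" and sub: "almost_subadditive \<sigma>"
    and \<delta>: "0 < \<delta>" "\<delta> < 1 / a"
  shows "growth_property \<omega> \<delta>"
proof -
  let ?\<tau> = "power_substitution \<omega> a"
  \<comment> \<open>The condition \<open>\<delta> < 1 / a\<close> says exactly that
    \<open>p > 1\<close>, which leaves room for a doubling factor \<open>r\<close> strictly between
    2 and \<open>2 powr p\<close>.\<close>
  define p where "p = 1 / (a * \<delta>)"
  have "p > 1" using a \<delta> by (simp add: p_def field_simps)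
  then have "2 powr 1 < (2::real) powr p" by (intro powr_less_mono) auto
  then obtain r where r: "2 < r" "r < 2 powr p" using dense[of 2 "2 powr p"] by auto
  have \<tau>: "weight_function ?\<tau>" using w a by (rule weight_function_power_substitution)
  obtain A where A: "A > 0" "\<forall>\<^sub>F t in at_top. \<sigma> t \<le> A * ?\<tau> t"
    using eq \<sigma> \<tau> unfolding equivalent_functions_def by (blast elim: bigo_weight_functionE)
  obtain B where B: "B > 0" "\<forall>\<^sub>F t in at_top. ?\<tau> t \<le> B * \<sigma> t"
    using eq \<sigma> \<tau> unfolding equivalent_functions_def by (blast elim: bigo_weight_functionE)
  have "1 < 2 powr p / r" using r by simp
  \<comment> \<open>The factor \<open>B * A\<close> is the cost of passing from
    \<open>\<sigma>\<close> to \<open>\<tau>\<close> and back, whatever \<open>n\<close> is. The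
    summand 1 makes the power exceed 1 even if \<open>B * A\<close> is small, which gives
    \<open>K > 1\<close> below.\<close>
  then obtain n where "B * A + 1 < (2 powr p / r) ^ n" using real_arch_pow by blast
  then have n: "1 < (2 powr p / r) ^ n" "B * A < (2 powr p / r) ^ n"
    using A(1) B(1) by (smt (verit) mult_pos_pos)+
  \<comment> \<open>Chosen so that \<open>K powr \<delta>\<close> equals
    \<open>2 powr (n / a)\<close>: then \<open>n\<close> doublings of the argument of
    \<open>\<tau>\<close> become multiplication by \<open>K powr \<delta>\<close> in the argument of
    \<open>\<omega>\<close>.\<close>
  define K where "K = (2 powr p) ^ n"
  have "1 \<le> r ^ n" using r by simp
  also have "r ^ n < K" using n(1) r by (simp add: K_def power_divide field_simps)
  finally have K: "K > 1" "B * A * r ^ n < K"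
    using n(2) r by (simp_all add: K_def power_divide field_simps)
  have lim2: "filterlim (\<lambda>t::real. 2 ^ n * t) at_top at_top"
    by (rule filterlim_tendsto_pos_mult_at_top[OF tendsto_const _ filterlim_ident]) simp
  have "\<forall>\<^sub>F t in at_top. \<sigma> (2 ^ n * t) \<le> r ^ n * \<sigma> t"
    using almost_subadditive_doubling[OF sub \<sigma> r(1)] r by (intro eventually_iterate_doubling) auto
  with A(2) eventually_compose_filterlim[OF B(2) lim2]
  have "\<forall>\<^sub>F t in at_top. ?\<tau> (2 ^ n * t) \<le> B * A * r ^ n * ?\<tau> t"
  proof eventually_elim
    case (elim t)
    have "?\<tau> (2 ^ n * t) \<le> B * \<sigma> (2 ^ n * t)" by (fact elim(2))
    also have "\<dots> \<le> B * (r ^ n * \<sigma> t)" using elim(3) B(1) by simp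
    also have "\<dots> \<le> B * (r ^ n * (A * ?\<tau> t))" using elim(1) B(1) r by simp
    finally show ?case by (simp add: mult_ac)
  qed
  from eventually_compose_filterlim[OF this filterlim_powr_at_top[OF a]] eventually_ge_at_top[of 0]
  have "\<forall>\<^sub>F t in at_top. \<omega> (K powr \<delta> * t) \<le> B * A * r ^ n * \<omega> t"
  proof eventually_elim
    case (elim t)
    have "K powr \<delta> = 2 powr (n * (p * \<delta>))"
      by (simp add: K_def powr_power powr_powr mult_ac)
    also have "p * \<delta> = 1 / a" using \<delta> by (simp add: p_def)
    finally have "2 ^ n * t powr a = (K powr \<delta> * t) powr a"
      using a elim(2) by (simp add: powr_mult powr_powr powr_realpow)
    then show ?case using elim a by (simp add: power_substitution_powr)
  qed
  with w K show ?thesis by (rule growth_propertyI)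
qed

lemma not_equivalent_almost_subadditive:
  assumes w: "weight_function \<omega>" and a: "a \<in> index_interval \<omega>" and "weight_function \<sigma>"
    and "equivalent_functions \<sigma> (power_substitution \<omega> a)"
  shows "\<not> almost_subadditive \<sigma>"
proof
  assume sub: "almost_subadditive \<sigma>"
  have "a > 0" using a by (rule index_interval_pos)
  then have "max 0 (growth_index \<omega>) < ereal (1 / a)"
    using index_interval_growth_index_less[OF a] by simp
  \<comment> \<open>Any such \<open>\<delta>\<close> gets a growth property although it lies above
    the growth index; the maximum with 0 makes it positive.\<close>
  then obtain \<delta> where \<delta>: "max 0 (growth_index \<omega>) < ereal \<delta>" "ereal \<delta> < ereal (1 / a)"
    by (blast dest: ereal_dense2)
  then have "growth_property \<omega> \<delta>"
    using assms sub \<open>a > 0\<close> by (intro growth_property_if_equivalent_almost_subadditive) auto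
  then have "ereal \<delta> \<le> growth_index \<omega>"
    using \<delta>(1) by (intro growth_property_le_growth_index) auto
  with \<delta>(1) show False by (simp add: leD)
qed

section \<open>BMT-weight functions\<close>

text \<open>Divergence comes from the logarithm being dominated by \<open>\<omega>\<close>.\<close>

lemma BMT_weight_function_weight_function:
  assumes "BMT_weight_function \<omega>"
  shows "weight_function \<omega>"
proof -
  have "(\<lambda>t. ln t) \<in> o[at_top](\<omega>)"
    using assms by (simp add: BMT_weight_function_def)
  then have "\<forall>\<^sub>F t in at_top. norm (ln t) \<le> 1 * norm (\<omega> t)"
    by (rule landau_o.smallD) simp
  with eventually_ge_at_top[of 1] have "\<forall>\<^sub>F t in at_top. ln t \<le> \<omega> t"
  proof eventually_elim
    case (elim t)
    then show ?case using assms by (auto simp: BMT_weight_function_def)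
  qed
  then have "filterlim \<omega> at_top at_top"
    by (rule filterlim_at_top_mono[OF ln_at_top])
  with assms show ?thesis by (simp add: BMT_weight_function_def weight_function_def)
qed

text \<open>Doubling \<open>t\<close> multiplies \<open>t powr (1 / a)\<close> by
  \<open>2 powr (1 / a)\<close>. By monotonicity, finitely many doublings of the argument of
  \<open>\<omega>\<close> dominate this factor.\<close>

lemma doubling_power_substitution:
  assumes w: "weight_function \<omega>" and a: "a > 0" and "(\<lambda>t. \<omega> (2 * t)) \<in> O[at_top](\<omega>)"
  shows "(\<lambda>t. power_substitution \<omega> a (2 * t)) \<in> O[at_top](power_substitution \<omega> a)"
proof -
  obtain C where C: "C > 0" "\<forall>\<^sub>F t in at_top. norm (\<omega> (2 * t)) \<le> C * norm (\<omega> t)"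
    using assms(3) by (elim landau_o.bigE)
  obtain n :: nat where "1 / a \<le> n" using real_arch_simple by blast
  then have n: "2 powr (1 / a) \<le> (2::real) ^ n" by (simp add: powr_mono flip: powr_realpow)
  have "\<forall>\<^sub>F t in at_top. \<omega> (2 * t) \<le> C * \<omega> t"
    using C(2) weight_function_eventually_ge[OF w, of 0] by eventually_elim auto
  then have "\<forall>\<^sub>F t in at_top. \<omega> (2 ^ n * t) \<le> C ^ n * \<omega> t"
    using C(1) by (intro eventually_iterate_doubling) auto
  then have "\<forall>\<^sub>F t in at_top. \<omega> (2 ^ n * t powr (1 / a)) \<le> C ^ n * \<omega> (t powr (1 / a))"
    using a by (intro eventually_compose_filterlim[OF _ filterlim_powr_at_top]) auto
  with eventually_ge_at_top[of 0]
  have "\<forall>\<^sub>F t in at_top. norm (power_substitution \<omega> a (2 * t))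
      \<le> C ^ n * norm (power_substitution \<omega> a t)"
  proof eventually_elim
    case (elim t)
    have "\<omega> (2 powr (1 / a) * t powr (1 / a)) \<le> \<omega> (2 ^ n * t powr (1 / a))"
      using n by (intro weight_function_mono[OF w] mult_right_mono) auto
    also have "\<dots> \<le> C ^ n * \<omega> (t powr (1 / a))" by (fact elim(2))
    finally show ?case
      using w elim(1) by (simp add: power_substitution_def powr_mult weight_function_def)
  qed
  then show ?thesis by (rule bigoI)
qed

lemma BMT_weight_function_power_substitution:
  assumes bmt: "BMT_weight_function \<omega>" and a: "a > 0"
  shows "BMT_weight_function (power_substitution \<omega> a)"
proof -
  let ?\<tau> = "power_substitution \<omega> a"
  have w: "weight_function \<omega>" using bmt by (rule BMT_weight_function_weight_function)
  have "weight_function ?\<tau>" using w a by (rule weight_function_power_substitution)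
  moreover have "continuous_on {0..} ?\<tau>"
  proof -
    have "continuous_on {0..} (\<lambda>t. t powr (1 / a))"
      using a by (intro continuous_on_powr' continuous_intros) auto
    moreover have "continuous_on {0..} \<omega>"
      using bmt by (simp add: BMT_weight_function_def)
    moreover have "(\<lambda>t. t powr (1 / a)) ` {0..} \<subseteq> {0..}" by auto
    ultimately have "continuous_on {0..} (\<lambda>t. \<omega> (t powr (1 / a)))"
      by (metis continuous_on_compose2)
    then show ?thesis by (simp add: power_substitution_def)
  qed
  moreover have "?\<tau> 0 = 0"
    using bmt by (simp add: power_substitution_def BMT_weight_function_def)
  moreover have "(\<lambda>t. ?\<tau> (2 * t)) \<in> O[at_top](?\<tau>)"
    using w a bmt by (intro doubling_power_substitution) (auto simp: BMT_weight_function_def)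
  moreover have "(\<lambda>t. ln t) \<in> o[at_top](?\<tau>)"
  proof -
    have "(\<lambda>t. ln (t powr (1 / a))) \<in> o[at_top](?\<tau>)"
      unfolding power_substitution_def using a bmt
      by (intro landau_o.small.compose[OF _ filterlim_powr_at_top])
        (auto simp: BMT_weight_function_def)
    moreover have "ln (t powr (1 / a)) = (1 / a) * ln t" for t
      by (simp add: ln_powr)
    ultimately show ?thesis using a by simp
  qed
  moreover have "convex_on UNIV (\<lambda>x. ?\<tau> (exp x))"
  proof -
    have "convex_on UNIV (\<lambda>x. \<omega> (exp x))"
      using bmt by (simp add: BMT_weight_function_def)
    \<comment> \<open>In logarithmic coordinates the power substitution is the linear rescaling of
      \<open>x\<close> to \<open>x / a\<close>, which preserves convexity.\<close>
    then have "convex_on UNIV (\<lambda>x. \<omega> (exp (x / a)))"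
      unfolding convex_on_def by (auto simp: add_divide_distrib simp flip: times_divide_eq_right)
    then show ?thesis by (simp add: power_substitution_def powr_def)
  qed
  ultimately show ?thesis by (simp add: BMT_weight_function_def weight_function_def)
qed

lemma normalized_power_substitution:
  assumes "normalized \<omega>" "a > 0"
  shows "normalized (power_substitution \<omega> a)"
  using assms by (auto simp: normalized_def power_substitution_def powr_le1)

theorem theorem3p3:
  fixes \<omega> :: "real \<Rightarrow> real"
  assumes "weight_function \<omega>" and "growth_index \<omega> < \<infinity>"
  defines "I \<equiv> index_interval \<omega>" and "\<tau> \<equiv> power_substitution \<omega>"
  shows
    "((\<forall>a\<in>I. weight_function (\<tau> a)) \<and>
      (\<forall>a\<in>I. \<forall>b\<in>I. a \<noteq> b \<longrightarrow> \<not> equivalent_functions (\<tau> a) (\<tau> b)) \<and>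
      uncountable (\<tau> ` I) \<and>
      (\<forall>a\<in>I. \<not> (\<exists>\<sigma>. weight_function \<sigma> \<and> equivalent_functions \<sigma> (\<tau> a) \<and>
                       almost_subadditive \<sigma>)) \<and>
      (\<forall>a\<in>I. \<not> almost_subadditive (\<tau> a))) \<and>
     (BMT_weight_function \<omega> \<longrightarrow> (\<forall>a\<in>I. BMT_weight_function (\<tau> a))) \<and>
     (BMT_weight_function \<omega> \<and> normalized \<omega> \<longrightarrow>
        (\<forall>a\<in>I. BMT_weight_function (\<tau> a) \<and> normalized (\<tau> a)))"
proof -
  note w = assms(1)
  have pos: "a > 0" if "a \<in> I" for a
    using that unfolding I_def by (rule index_interval_pos)
  have weight: "weight_function (\<tau> a)" if "a \<in> I" for a
    unfolding \<tau>_def using w pos[OF that] by (rule weight_function_power_substitution)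
  have noneq: "\<not> equivalent_functions (\<tau> a) (\<tau> b)" if "a \<in> I" "b \<in> I" "a \<noteq> b" for a b
    using power_substitution_not_bigo[OF assms(1,2)] pos that
    unfolding equivalent_functions_def \<tau>_def by (metis linorder_neqE)
  have equiv_refl: "equivalent_functions f f" for f
    by (simp add: equivalent_functions_def)
  \<comment> \<open>Equal functions are equivalent, so non-equivalence for distinct parameters
    forces injectivity, and uncountability passes from \<open>I\<close> to the family.\<close>
  have "inj_on \<tau> I" using noneq equiv_refl by (metis inj_onI)
  then have unc: "uncountable (\<tau> ` I)"
    using uncountable_index_interval[OF assms(2)] countable_image_inj_on unfolding I_def by blast
  have nosub: "\<not> almost_subadditive \<sigma>"
    if "a \<in> I" "weight_function \<sigma>" "equivalent_functions \<sigma> (\<tau> a)" for a \<sigma>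
    using not_equivalent_almost_subadditive[OF w] that unfolding I_def \<tau>_def by blast
  have bmt: "BMT_weight_function (\<tau> a)" if "BMT_weight_function \<omega>" "a \<in> I" for a
    unfolding \<tau>_def using that(1) pos[OF that(2)] by (rule BMT_weight_function_power_substitution)
  have norm: "normalized (\<tau> a)" if "normalized \<omega>" "a \<in> I" for a
    unfolding \<tau>_def using that(1) pos[OF that(2)] by (rule normalized_power_substitution)
  have nosub': "\<not> almost_subadditive (\<tau> a)" if "a \<in> I" for a
    using nosub[OF that weight[OF that] equiv_refl] .
  show ?thesis
    by (intro conjI ballI impI notI; (elim exE conjE)?)
      (simp_all add: weight noneq unc nosub nosub' bmt norm)
qed

end
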